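(* Let $D$ be a $3$-anti-traceable oriented graph with $|V(D)|\geq 5$. If $|V(D)|$ is even, then $D$ has a hamiltonian anti-directed cycle. If $|V(D)|$ is odd, then $D$ has an anti-directed cycle of length $|V(D)|-1$ and a hamiltonian anti-directed path.
   Context: An oriented graph is a digraph obtained by orienting the edges of a simple undirected graph. An oriented path $x_1\dots x_p$ is anti-directed if every two consecutive arcs have opposite orientations; an anti-directed cycle is an oriented cycle in which every two cyclically consecutive arcs have opposite orientations. Hamiltonian means containing all vertices; the length of a cycle is its number of vertices. A digraph is anti-traceable if it has a hamiltonian anti-directed path, and $k$-anti-traceable if it has at least $k$ vertices and every induced subdigraph on $k$ vertices is anti-traceable. *)

theory Defs
  imports "Graph_Theory.Digraph_Component"
begin

locale oriented_graph = digraph +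
  assumes asym_arcs: "asym (arcs_ends G)"

lemma (in fin_digraph) oriented_graph_iff_orientation:
  "oriented_graph G \<longleftrightarrow>
    (\<exists>E. (\<forall>X\<in>E. X \<subseteq> verts G \<and> card X = 2) \<and>
         bij_betw (\<lambda>e. {tail G e, head G e}) (arcs G) E)"
  (is "?L \<longleftrightarrow> ?R")
proof
  assume ?L
  then interpret O: oriented_graph G .
  let ?f = "\<lambda>e. {tail G e, head G e}"
  have "inj_on ?f (arcs G)"
  proof (rule inj_onI)
    fix e1 e2
    assume e: "e1 \<in> arcs G" "e2 \<in> arcs G" "?f e1 = ?f e2"
    have "\<not> (tail G e1 = head G e2 \<and> head G e1 = tail G e2)"
    proof
      assume swap: "tail G e1 = head G e2 \<and> head G e1 = tail G e2"
      have "(tail G e1, head G e1) \<in> arcs_ends G"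
        using e(1) by (auto simp: arcs_ends_conv)
      moreover have "(head G e1, tail G e1) \<in> arcs_ends G"
        using e(2) swap by (auto simp: arcs_ends_conv)
      ultimately show False
        using O.asym_arcs by (meson asymD)
    qed
    with e(3) have "arc_to_ends G e1 = arc_to_ends G e2"
      by (auto simp: doubleton_eq_iff arc_to_ends_def)
    with e show "e1 = e2" by (blast intro: O.no_multi_arcs)
  qed
  moreover have "\<forall>X\<in>?f ` arcs G. X \<subseteq> verts G \<and> card X = 2"
    using O.no_loops by (auto simp: card_insert_if)
  ultimately show ?R by (meson inj_on_imp_bij_betw)
next
  assume ?R
  then obtain E where E: "\<forall>X\<in>E. X \<subseteq> verts G \<and> card X = 2"
    and b: "bij_betw (\<lambda>e. {tail G e, head G e}) (arcs G) E"
    by blast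
  have loop: "tail G e \<noteq> head G e" if "e \<in> arcs G" for e
  proof -
    have "card {tail G e, head G e} = 2"
      using E b that by (auto simp: bij_betw_def)
    then show ?thesis by auto
  qed
  have inj: "e1 = e2"
    if "e1 \<in> arcs G" "e2 \<in> arcs G" "{tail G e1, head G e1} = {tail G e2, head G e2}" for e1 e2
    using b that by (auto simp: bij_betw_def dest: inj_onD)
  show ?L
  proof unfold_locales
    show "asym (arcs_ends G)"
    proof (rule asymI)
      fix u v
      assume "(u, v) \<in> arcs_ends G"
      then obtain e1 where e1: "e1 \<in> arcs G" "tail G e1 = u" "head G e1 = v" by (rule reachableE)
      show "(v, u) \<notin> arcs_ends G"
      proof
        assume "(v, u) \<in> arcs_ends G"
        then obtain e2 where e2: "e2 \<in> arcs G" "tail G e2 = v" "head G e2 = u" by (rule reachableE)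
        have "e1 = e2" using e1 e2 by (intro inj) auto
        with e1 e2 loop[OF e1(1)] show False by simp
      qed
    qed
  qed (use loop inj in \<open>auto simp: arc_to_ends_def\<close>)
qed

definition arc_dir :: "('a, 'b) pre_digraph \<Rightarrow> bool \<Rightarrow> 'a \<Rightarrow> 'a \<Rightarrow> bool" where
  "arc_dir G b u v \<longleftrightarrow> (if b then u \<rightarrow>\<^bsub>G\<^esub> v else v \<rightarrow>\<^bsub>G\<^esub> u)"

text \<open>
  In the next two definitions, \<open>d i\<close> records whether the \<open>i\<close>-th arc of the oriented path
  (or cycle) is traversed forwards or backwards.
\<close>

definition anti_directed_path :: "('a, 'b) pre_digraph \<Rightarrow> 'a list \<Rightarrow> bool" where
  "anti_directed_path G xs \<longleftrightarrow>
     xs \<noteq> [] \<and> distinct xs \<and> set xs \<subseteq> verts G \<and>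
     (\<exists>d :: nat \<Rightarrow> bool.
        (\<forall>i. Suc i < length xs \<longrightarrow> arc_dir G (d i) (xs ! i) (xs ! Suc i)) \<and>
        (\<forall>i. Suc (Suc i) < length xs \<longrightarrow> d i \<noteq> d (Suc i)))"

definition anti_directed_cycle :: "('a, 'b) pre_digraph \<Rightarrow> 'a list \<Rightarrow> bool" where
  "anti_directed_cycle G xs \<longleftrightarrow>
     3 \<le> length xs \<and> distinct xs \<and> set xs \<subseteq> verts G \<and>
     (\<exists>d :: nat \<Rightarrow> bool.
        (\<forall>i < length xs. arc_dir G (d i) (xs ! i) (xs ! (Suc i mod length xs))) \<and>
        (\<forall>i < length xs. d i \<noteq> d (Suc i mod length xs)))"

definition hamiltonian :: "('a, 'b) pre_digraph \<Rightarrow> 'a list \<Rightarrow> bool" where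
  "hamiltonian G xs \<longleftrightarrow> set xs = verts G"

definition anti_traceable :: "('a, 'b) pre_digraph \<Rightarrow> bool" where
  "anti_traceable G \<longleftrightarrow> (\<exists>xs. anti_directed_path G xs \<and> hamiltonian G xs)"

definition k_anti_traceable :: "nat \<Rightarrow> ('a, 'b) pre_digraph \<Rightarrow> bool" where
  "k_anti_traceable k G \<longleftrightarrow>
     k \<le> card (verts G) \<and>
     (\<forall>S \<subseteq> verts G. card S = k \<longrightarrow> anti_traceable (G \<restriction> S))"

end

theory Submission
  imports Defs
begin

text \<open>
  Three vertices span a hamiltonian anti-directed path exactly if they induce a transitive triangle
  or two arcs sharing their tail or sharing their head. Hence in-neighbourhoods are nested and
  non-adjacent vertices are twins, with no three vertices pairwise non-adjacent. Sorting by in-degree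
  therefore lists the vertices as \<open>v\<^sub>0, \<dots>, v\<^sub>n\<^sub>-\<^sub>1\<close> so that \<open>v\<^sub>i\<close> dominates \<open>v\<^sub>j\<close> whenever
  \<open>i + 2 \<le> j\<close>. Alternating between an initial and a final segment of this list gives both
  the cycle and the path.
\<close>

text \<open>The path may visit the triple in any order, so its vertices get new names, with
  \<open>b\<close> in the middle; alternation at \<open>b\<close> makes it a common head or a common
  tail.\<close>

lemma k_anti_traceable_3_triple:
  assumes "k_anti_traceable 3 D" "{x, y, z} \<subseteq> verts D" "x \<noteq> y" "x \<noteq> z" "y \<noteq> z"
  obtains a b c where "{a, b, c} = {x, y, z}"
    "a \<rightarrow>\<^bsub>D\<^esub> b \<and> c \<rightarrow>\<^bsub>D\<^esub> b \<or> b \<rightarrow>\<^bsub>D\<^esub> a \<and> b \<rightarrow>\<^bsub>D\<^esub> c"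
proof -
  let ?H = "D \<restriction> {x, y, z}"
  have "card {x, y, z} = 3" using assms by simp
  with assms have "anti_traceable ?H" unfolding k_anti_traceable_def by blast
  then obtain xs d where xs: "distinct xs" "set xs = {x, y, z}"
    and d: "\<And>i. Suc i < length xs \<Longrightarrow> arc_dir ?H (d i) (xs ! i) (xs ! Suc i)"
    and alt: "\<And>i. Suc (Suc i) < length xs \<Longrightarrow> d i \<noteq> d (Suc i)"
    unfolding anti_traceable_def anti_directed_path_def hamiltonian_def
    by auto
  have len: "length xs = 3"
    using xs \<open>card {x, y, z} = 3\<close> distinct_card by metis
  then obtain a b c where abc: "xs = [a, b, c]"
    by (auto simp: numeral_3_eq_3 length_Suc_conv)
  have sub: "u \<rightarrow>\<^bsub>D\<^esub> v" if "u \<rightarrow>\<^bsub>?H\<^esub> v" for u v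
    using that by (auto simp: arcs_ends_conv induce_subgraph_def)
  have "a \<rightarrow>\<^bsub>D\<^esub> b \<and> c \<rightarrow>\<^bsub>D\<^esub> b \<or> b \<rightarrow>\<^bsub>D\<^esub> a \<and> b \<rightarrow>\<^bsub>D\<^esub> c"
    using d[of 0] d[of 1] alt[of 0] abc
    by (auto simp: arc_dir_def split: if_splits dest: sub)
  with xs(2) abc show thesis by (intro that[of a b c]) auto
qed

text \<open>The cycle is \<open>v 0, v c, v 1, v (c + 1), ..., v (m - 1), v (c + m - 1)\<close>.
  Apart from the closing arc, index gaps are \<open>c\<close> and \<open>c - 1\<close>, hence the
  bound 3 on \<open>c\<close>; \<open>m \<le> c\<close> keeps the two segments disjoint.\<close>

lemma anti_directed_cycle_alternating:
  assumes "\<And>i j. i + 2 \<le> j \<Longrightarrow> j < n \<Longrightarrow> v i \<rightarrow>\<^bsub>D\<^esub> v j" "inj_on v {..<n}" "v ` {..<n} \<subseteq> verts D"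
    and "2 \<le> m" "3 \<le> c" "m \<le> c" "c + m \<le> n"
  shows "anti_directed_cycle D
    (map (\<lambda>k. if even k then v (k div 2) else v (c + k div 2)) [0..<2 * m])"
    (is "anti_directed_cycle D ?xs")
proof -
  let ?g = "\<lambda>k. if even k then k div 2 else c + k div 2"
  have xs: "?xs = map (\<lambda>k. v (?g k)) [0..<2 * m]" by auto
  have lt: "?g k < n" if "k < 2 * m" for k using that assms(4-) by auto
  have ginj: "inj_on ?g {..<2 * m}"
  proof (rule inj_onI)
    fix k l assume "k \<in> {..<2 * m}" "l \<in> {..<2 * m}" "?g k = ?g l"
    then have kl: "k < 2 * m" "l < 2 * m" "?g k = ?g l" by auto
    with \<open>m \<le> c\<close> show "k = l"
      by (auto split: if_splits elim!: evenE oddE)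
  qed
  have "inj_on (\<lambda>k. v (?g k)) {..<2 * m}"
    using comp_inj_on[OF ginj inj_on_subset[OF assms(2) image_subsetI]] lt
    by (simp add: comp_def del: if_split)
  then have dist: "distinct ?xs"
    unfolding xs by (simp add: distinct_map atLeast0LessThan)
  have sub: "set ?xs \<subseteq> verts D"
    using assms(3) lt unfolding xs by (auto simp del: if_split)
  have arc: "arc_dir D (even k) (?xs ! k) (?xs ! (Suc k mod (2 * m)))" if "k < 2 * m" for k
  proof (cases "Suc k = 2 * m")
    \<comment> \<open>The closing arc runs from \<open>v 0\<close> to
      \<open>v (c + m - 1)\<close>.\<close>
    case True
    then have "odd k" "k div 2 = m - 1" by presburger+
    with True that show ?thesis using assms(4-) by (auto simp: arc_dir_def intro!: assms(1))
  next
    case False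
    with that show ?thesis using assms(4-)
      by (auto simp: arc_dir_def intro!: assms(1) elim!: evenE oddE)
  qed
  \<comment> \<open>The modulus is even, so parity also alternates across the wrap-around.\<close>
  have alt: "even k \<noteq> even (Suc k mod (2 * m))" for k
    by (simp add: dvd_mod_iff)
  have len: "length ?xs = 2 * m" by simp
  have "3 \<le> 2 * m" using \<open>2 \<le> m\<close> by simp
  with dist sub arc alt show ?thesis
    unfolding anti_directed_cycle_def len by blast
qed

text \<open>The path is \<open>v m, v 0, v (m + 1), v 1, ..., v (m - 1), v (2 * m)\<close>. Its odd
  positions are tails and its index gaps are \<open>m\<close> and \<open>m + 1\<close>, both at
  least 2.\<close>

lemma anti_directed_path_alternating:
  fixes v :: "nat \<Rightarrow> 'a"
  assumes "\<And>i j. i + 2 \<le> j \<Longrightarrow> j < 2 * m + 1 \<Longrightarrow> v i \<rightarrow>\<^bsub>D\<^esub> v j"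
    and "inj_on v {..<2 * m + 1}" "v ` {..<2 * m + 1} = verts D" "2 \<le> m"
  obtains xs where "anti_directed_path D xs" "hamiltonian D xs"
proof -
  let ?N = "2 * m + 1"
  let ?g = "\<lambda>k. if even k then m + k div 2 else k div 2"
  let ?xs = "map (\<lambda>k. v (?g k)) [0..<?N]"
  have ginj: "inj_on ?g {..<?N}"
    by (rule inj_onI) (auto split: if_splits elim!: evenE oddE)
  \<comment> \<open>An injective self-map of a finite set is a permutation, so the path misses no
    vertex.\<close>
  have "?g ` {..<?N} \<subseteq> {..<?N}" by auto
  then have gim: "?g ` {..<?N} = {..<?N}"
    by (intro endo_inj_surj ginj) simp_all
  have "inj_on (\<lambda>k. v (?g k)) {..<?N}"
    using comp_inj_on[OF ginj] assms(2) gim by (simp add: comp_def)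
  then have dist: "distinct ?xs"
    by (simp only: distinct_map distinct_upt set_upt atLeast0LessThan)
  have "set ?xs = v ` ?g ` {..<?N}"
    by (simp only: set_map set_upt atLeast0LessThan image_image)
  then have set: "set ?xs = verts D" using gim assms(3) by simp
  have arc: "arc_dir D (odd k) (?xs ! k) (?xs ! Suc k)" if "Suc k < ?N" for k
    using that \<open>2 \<le> m\<close>
    by (auto simp: arc_dir_def nth_append intro!: assms(1) elim!: evenE oddE)
  have "anti_directed_path D ?xs"
    unfolding anti_directed_path_def
  proof (intro conjI exI[of _ odd] allI impI)
    show "arc_dir D (odd k) (?xs ! k) (?xs ! Suc k)" if "Suc k < length ?xs" for k
      using that by (intro arc) simp
  qed (use dist set in \<open>simp_all del: upt_Suc\<close>)
  with set show thesis by (intro that) (simp_all only: hamiltonian_def)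
qed

context oriented_graph
begin

lemma dominates_asym: "u \<rightarrow> v \<Longrightarrow> \<not> v \<rightarrow> u"
  using asym_arcs by (meson asymD)

text \<open>Otherwise, for distinct vertices, the only possible arcs on the triple are
  \<open>x \<rightarrow> u\<close>, \<open>u \<rightarrow> w\<close> and
  \<open>w \<rightarrow> x\<close>, no two of which share a head or a tail.\<close>

lemma in_neighbours_nested:
  assumes "k_anti_traceable 3 G" "x \<rightarrow> u" "\<not> w \<rightarrow> u" "w \<in> verts G"
  shows "x \<rightarrow> w"
proof (cases "w = u")
  case False
  have V: "x \<in> verts G" "u \<in> verts G" using assms(2) by auto
  have "x \<noteq> u" "x \<noteq> w" using assms dominates_asym by blast+
  with False V assms obtain a b c where "{a, b, c} = {x, u, w}"
    "a \<rightarrow> b \<and> c \<rightarrow> b \<or> b \<rightarrow> a \<and> b \<rightarrow> c"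
    by (elim k_anti_traceable_3_triple[of G x u w]) auto
  with assms \<open>x \<noteq> u\<close> \<open>x \<noteq> w\<close> False show ?thesis
    using dominates_asym by (smt (verit) insert_iff singletonD insertI1)
qed (use assms in simp)

lemma k_anti_traceable_3_enumeration:
  assumes "k_anti_traceable 3 G"
  obtains v where "bij_betw v {..<card (verts G)} (verts G)"
    "\<And>i j. i + 2 \<le> j \<Longrightarrow> j < card (verts G) \<Longrightarrow> v i \<rightarrow> v j"
proof -
  define f where "f w = card {x. x \<rightarrow> w}" for w
  have fin: "finite {x. x \<rightarrow> w}" for w
    by (rule finite_subset[OF _ finite_verts]) auto
  have f_le: "f u \<le> f w" if "\<not> w \<rightarrow> u" "w \<in> verts G" for u w
    unfolding f_def using in_neighbours_nested[OF assms _ that] fin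
    by (intro card_mono) auto
  \<comment> \<open>Strict because \<open>u\<close> itself is an in-neighbour of \<open>w\<close>
    but not of \<open>u\<close>.\<close>
  have f_less: "f u < f w" if "u \<rightarrow> w" for u w
  proof -
    have "{x. x \<rightarrow> u} \<subseteq> {x. x \<rightarrow> w}"
      using in_neighbours_nested[OF assms _ dominates_asym[OF that]] that by auto
    moreover have "u \<notin> {x. x \<rightarrow> u}" using dominates_asym by blast
    ultimately show ?thesis
      unfolding f_def using that fin by (intro psubset_card_mono) auto
  qed
  obtain ys where ys: "set ys = verts G" "distinct ys"
    using finite_distinct_list[OF finite_verts] by blast
  define xs where "xs = sort_key f ys"
  have xs: "set xs = verts G" "distinct xs" "sorted (map f xs)"
    using ys by (auto simp: xs_def)
  have len: "length xs = card (verts G)" using xs distinct_card by metis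
  show thesis
  proof (rule that[of "(!) xs"])
    show "bij_betw ((!) xs) {..<card (verts G)} (verts G)"
      using bij_betw_nth[OF xs(2)] xs(1) len by simp
  next
    fix i j assume ij: "i + 2 \<le> j" "j < card (verts G)"
    \<comment> \<open>The gap of 2 leaves room for a third vertex \<open>?w\<close>. Without the arc
      from \<open>?u\<close> to \<open>?z\<close>, all three in-degrees coincide, so
      \<open>f_less\<close> rules out every arc among them.\<close>
    let ?u = "xs ! i" and ?w = "xs ! Suc i" and ?z = "xs ! j"
    have V: "?u \<in> verts G" "?w \<in> verts G" "?z \<in> verts G"
      using ij len xs(1) nth_mem by (metis Suc_lessD add_2_eq_Suc' less_trans_Suc Suc_le_eq order.strict_trans)+
    have ne: "?u \<noteq> ?w" "?u \<noteq> ?z" "?w \<noteq> ?z"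
      using ij len xs(2) by (auto simp: nth_eq_iff_index_eq)
    have le: "f ?u \<le> f ?w" "f ?w \<le> f ?z"
      using sorted_nth_mono[OF xs(3), of i "Suc i"] sorted_nth_mono[OF xs(3), of "Suc i" j] ij len
      by auto
    show "?u \<rightarrow> ?z"
    proof (rule ccontr)
      assume "\<not> ?u \<rightarrow> ?z"
      then have "f ?z \<le> f ?u" using f_le V by blast
      with le have "f ?u = f ?w" "f ?w = f ?z" by auto
      then have "\<not> p \<rightarrow> q" if "p \<in> {?u, ?w, ?z}" "q \<in> {?u, ?w, ?z}" for p q
        using that f_less[of p q] by auto
      then show False
        using k_anti_traceable_3_triple[OF assms, of ?u ?w ?z] V ne
        by (metis empty_subsetI insert_subset insertCI)
    qed
  qed
qed

end

theorem theorem3: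
  fixes D :: "('a, 'b) pre_digraph"
  assumes "oriented_graph D"
    and "k_anti_traceable 3 D"
    and "card (verts D) \<ge> 5"
  shows "(even (card (verts D)) \<longrightarrow>
            (\<exists>xs. anti_directed_cycle D xs \<and> hamiltonian D xs)) \<and>
         (odd (card (verts D)) \<longrightarrow>
            (\<exists>xs. anti_directed_cycle D xs \<and> length xs = card (verts D) - 1) \<and>
            (\<exists>xs. anti_directed_path D xs \<and> hamiltonian D xs))"
proof -
  interpret oriented_graph D by fact
  let ?n = "card (verts D)"
  obtain v where v: "bij_betw v {..<?n} (verts D)"
    and dom: "\<And>i j. i + 2 \<le> j \<Longrightarrow> j < ?n \<Longrightarrow> v i \<rightarrow>\<^bsub>D\<^esub> v j"
    using k_anti_traceable_3_enumeration[OF assms(2)] by blast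
  have inj: "inj_on v {..<?n}" and im: "v ` {..<?n} = verts D"
    using v by (auto simp: bij_betw_def)
  \<comment> \<open>One choice serves both parities: for even order the two segments are the halves
    of the list, for odd order only the middle vertex is left out. Order at least 5 gives
    \<open>2 \<le> m\<close> and \<open>3 \<le> c\<close>.\<close>
  obtain xs where cyc: "anti_directed_cycle D xs" and len: "length xs = 2 * (?n div 2)"
    using anti_directed_cycle_alternating[OF dom inj, of "?n div 2" "?n - ?n div 2"] im assms(3)
    by fastforce
  have "hamiltonian D xs" if "even ?n"
  proof -
    have "distinct xs" "set xs \<subseteq> verts D" using cyc by (auto simp: anti_directed_cycle_def)
    moreover have "length xs = ?n" using len that by simp
    ultimately show ?thesis
      unfolding hamiltonian_def by (metis card_subset_eq distinct_card finite_verts)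
  qed
  moreover have "\<exists>ys. anti_directed_path D ys \<and> hamiltonian D ys" if "odd ?n"
  proof -
    from that obtain m where m: "?n = 2 * m + 1" by (elim oddE)
    with assms(3) have "2 \<le> m" by simp
    from anti_directed_path_alternating[OF dom[unfolded m] inj[unfolded m] im[unfolded m] this]
    show ?thesis by blast
  qed
  moreover have "length xs = ?n - 1" if "odd ?n"
    using len that by (auto elim: oddE)
  ultimately show ?thesis using cyc by blast
qed

end
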